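(* Let $d\ge 1$ and $n\ge 1$ be integers. For every set $P\subset\mathbb{R}^d$ of $n$ points in general position, there exists an order of $P$ such that the corresponding ordered Nearest Neighbor Graph has maximum indegree at least $\frac{\log_2 n}{4d}$.
   Context: Distances in $\mathbb{R}^d$ are Euclidean. A point set is in general position if no three of its points determine a (possibly degenerate) isosceles triangle, i.e., there are no three distinct points $x,y,z$ in the set such that the distance from $x$ to $y$ equals the distance from $x$ to $z$. An order of a finite set $P$ with $|P|=n$ is an enumeration $(p_1,\dots,p_n)$ of all its elements, each appearing exactly once. The ordered Nearest Neighbor Graph corresponding to this order is the directed graph on vertex set $P$ in which, for each $2\le i\le n$, there is exactly one edge going out of $p_i$, namely the edge $p_i\to p_j$ where $p_j$ is the (unique, by general position) point of $\{p_1,\dots,p_{i-1}\}$ closest to $p_i$; the point $p_1$ has no outgoing edge. The indegree of a point is the number of edges pointing to it, and the maximum indegree is the maximum of the indegrees over all points of $P$. *)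

theory Defs
  imports "HOL-Analysis.Analysis" "Graph_Theory.Pair_Digraph"
begin

definition general_position :: "'a::metric_space set \<Rightarrow> bool" where
  "general_position P \<longleftrightarrow>
     (\<forall>x\<in>P. \<forall>y\<in>P. \<forall>z\<in>P. x \<noteq> y \<and> y \<noteq> z \<and> x \<noteq> z \<longrightarrow> dist x y \<noteq> dist x z)"

definition is_order :: "'a set \<Rightarrow> 'a list \<Rightarrow> bool" where
  "is_order P ps \<longleftrightarrow> distinct ps \<and> set ps = P"

text \<open>Lists are indexed from 0, so \<open>ps ! 0\<close> is the first point; it has no outgoing arc.\<close>

definition ordered_NNG :: "'a::metric_space list \<Rightarrow> 'a pair_pre_digraph" where
  "ordered_NNG ps =
     \<lparr> pverts = set ps,
       parcs = {(ps ! i, ps ! j) | i j. i < length ps \<and> j < i \<and>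
                  (\<forall>k<i. dist (ps ! i) (ps ! j) \<le> dist (ps ! i) (ps ! k))} \<rparr>"

definition max_in_degree :: "('a, 'b) pre_digraph \<Rightarrow> nat" where
  "max_in_degree G = Max (in_degree G ` verts G)"

text \<open>
  The arcs above are given by a non-strict minimum. In general position it is attained exactly
  once, so every point but the first has exactly one outgoing arc.
\<close>

lemma ordered_NNG_ex1_out_arc:
  assumes gp: "general_position P" and ord: "is_order P ps"
    and i: "0 < i" "i < length ps"
  shows "\<exists>!q. (ps ! i, q) \<in> parcs (ordered_NNG ps)"
proof -
  have dis: "distinct ps" and P: "set ps = P"
    using ord by (auto simp: is_order_def)
  have arc: "(ps ! i, q) \<in> parcs (ordered_NNG ps) \<longleftrightarrow>
      (\<exists>j<i. q = ps ! j \<and> (\<forall>k<i. dist (ps ! i) (ps ! j) \<le> dist (ps ! i) (ps ! k)))" for q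
  proof
    assume "(ps ! i, q) \<in> parcs (ordered_NNG ps)"
    then obtain i' j where *: "ps ! i = ps ! i'" "q = ps ! j" "i' < length ps" "j < i'"
        "\<forall>k<i'. dist (ps ! i') (ps ! j) \<le> dist (ps ! i') (ps ! k)"
      unfolding ordered_NNG_def by auto
    then have "i' = i"
      using i(2) dis nth_eq_iff_index_eq by metis
    with * show "\<exists>j<i. q = ps ! j \<and> (\<forall>k<i. dist (ps ! i) (ps ! j) \<le> dist (ps ! i) (ps ! k))"
      by blast
  next
    assume "\<exists>j<i. q = ps ! j \<and> (\<forall>k<i. dist (ps ! i) (ps ! j) \<le> dist (ps ! i) (ps ! k))"
    with i(2) show "(ps ! i, q) \<in> parcs (ordered_NNG ps)"
      unfolding ordered_NNG_def by auto
  qed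
  obtain j where j: "j < i" "\<And>k. k < i \<Longrightarrow> dist (ps ! i) (ps ! j) \<le> dist (ps ! i) (ps ! k)"
  proof -
    define m where "m = arg_min_on (\<lambda>k. dist (ps ! i) (ps ! k)) {..<i}"
    have ne: "finite {..<i}" "{..<i} \<noteq> {}"
      using i(1) by auto
    have "m < i"
      using arg_min_if_finite(1)[OF ne] unfolding m_def by blast
    moreover have "dist (ps ! i) (ps ! m) \<le> dist (ps ! i) (ps ! k)" if "k < i" for k
      unfolding m_def using that ne by (intro arg_min_least) auto
    ultimately show ?thesis
      by (rule that)
  qed
  have uniq: "ps ! l = ps ! j"
    if l: "l < i" "\<And>k. k < i \<Longrightarrow> dist (ps ! i) (ps ! l) \<le> dist (ps ! i) (ps ! k)" for l
  proof (rule ccontr)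
    assume "ps ! l \<noteq> ps ! j"
    moreover have "ps ! i \<noteq> ps ! l" "ps ! i \<noteq> ps ! j"
      using i j(1) l(1) dis by (auto simp: nth_eq_iff_index_eq)
    moreover have "ps ! i \<in> P" "ps ! l \<in> P" "ps ! j \<in> P"
      using i j(1) l(1) P by auto
    ultimately have "dist (ps ! i) (ps ! l) \<noteq> dist (ps ! i) (ps ! j)"
      using gp unfolding general_position_def by blast
    with j l show False by (meson order_antisym)
  qed
  show ?thesis
  proof (rule ex1I)
    show "(ps ! i, ps ! j) \<in> parcs (ordered_NNG ps)"
      unfolding arc by (intro exI[of _ j]) (simp add: j)
  next
    fix q assume "(ps ! i, q) \<in> parcs (ordered_NNG ps)"
    then obtain l where "l < i" "q = ps ! l" "\<forall>k<i. dist (ps ! i) (ps ! l) \<le> dist (ps ! i) (ps ! k)"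
      unfolding arc by auto
    then show "q = ps ! j"
      using uniq[of l] by simp
  qed
qed

lemma ordered_NNG_fin_digraph:
  shows "pair_fin_digraph (ordered_NNG ps)"
proof -
  have "parcs (ordered_NNG ps) \<subseteq> set ps \<times> set ps"
    by (auto simp: ordered_NNG_def)
  moreover from this have "finite (parcs (ordered_NNG ps))"
    by (rule finite_subset) simp
  moreover have "pverts (ordered_NNG ps) = set ps"
    by (simp add: ordered_NNG_def)
  ultimately show ?thesis
    by unfold_locales auto
qed

end

theory Submission
  imports Defs
begin

text \<open>
  List first a point \<open>c\<close> and then points \<open>q\<^sub>1, \<dots>, q\<^sub>k\<close>, each of which is closer to \<open>c\<close> than to all
  of its predecessors \<open>q\<^sub>j\<close>. Then every \<open>q\<^sub>i\<close> sends its arc to \<open>c\<close>, however the other points are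
  appended, so \<open>c\<close> has indegree at least \<open>k\<close>. It remains to find such a configuration with
  \<open>n \<le> 16 ^ (d * k)\<close>.

  The configuration is built by descending through scales. Let \<open>P\<close> have diameter \<open>D > 0\<close>. A volume
  argument covers \<open>P\<close> by at most \<open>15 ^ d\<close> balls of radius \<open>D / 7\<close> with centres in \<open>P\<close>; let \<open>Q\<close> be
  the part of \<open>P\<close> in the most popular of them, with centre \<open>x\<close>. One end \<open>q\<close> of a diameter of \<open>P\<close> has
  distance at least \<open>D / 2\<close> from \<open>x\<close>, hence at least \<open>D / 2 - D / 7 = 5 D / 14\<close> from all of \<open>Q\<close>, while
  any two points of \<open>Q\<close> are within \<open>2 D / 7 = 4 D / 14\<close> of each other. So whatever configuration the
  induction hypothesis finds inside \<open>Q\<close>, the point \<open>q\<close> can be put in front of its list: the length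
  grows by one, at the price of a factor of at most \<open>16 ^ d\<close> in the number of points. The lemma
  \<open>ex_popular_far_ball\<close> is one such step and \<open>ex_NN_star\<close> is the iteration.
\<close>

section \<open>Popular balls\<close>

text \<open>
  The open balls of radius \<open>r / 2\<close> around the points of \<open>X\<close> are disjoint and lie in the ball of
  radius \<open>R + r / 2\<close> around \<open>a\<close>; compare volumes and cancel the volume of the unit ball.
\<close>

lemma packing_bound:
  fixes X :: "'a::euclidean_space set"
  assumes fin: "finite X" and sub: "X \<subseteq> cball a R" and sep: "pairwise (\<lambda>x y. r \<le> dist x y) X"
    and pos: "0 < r" "0 \<le> R"
  shows "real (card X) * r ^ DIM('a) \<le> (2 * R + r) ^ DIM('a)"
proof -
  let ?V = "unit_ball_vol (real DIM('a))"
  have disj: "disjoint_family_on (\<lambda>x. ball x (r/2)) X"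
    unfolding disjoint_family_on_def
  proof (intro ballI impI)
    fix x y assume "x \<in> X" "y \<in> X" "x \<noteq> y"
    then have "r \<le> dist x y"
      using sep by (auto simp: pairwise_def)
    then show "ball x (r/2) \<inter> ball y (r/2) = {}"
      by (intro disjoint_ballI) simp
  qed
  have incl: "(\<Union>x\<in>X. ball x (r/2)) \<subseteq> ball a (R + r/2)"
  proof
    fix z assume "z \<in> (\<Union>x\<in>X. ball x (r/2))"
    then obtain x where "x \<in> X" "dist x z < r/2" by auto
    moreover from this have "dist a x \<le> R" using sub by auto
    ultimately show "z \<in> ball a (R + r/2)"
      using dist_triangle[of a z x] by simp
  qed
  have "real (card X) * (?V * (r/2) ^ DIM('a)) = (\<Sum>x\<in>X. measure lborel (ball x (r/2)))"
    using pos by (simp add: content_ball)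
  also have "\<dots> = measure lborel (\<Union>x\<in>X. ball x (r/2))"
    using fin disj
    by (intro measure_finite_Union[symmetric]) (auto simp: less_imp_neq[OF emeasure_lborel_ball_finite, simplified])
  also have "\<dots> \<le> measure lborel (ball a (R + r/2))"
    using incl fin
    by (intro measure_mono_fmeasurable) (auto simp: fmeasurable_def emeasure_lborel_ball_finite[simplified])
  also have "\<dots> = ?V * (R + r/2) ^ DIM('a)"
    using pos by (simp add: content_ball)
  finally have "real (card X) * (r/2) ^ DIM('a) \<le> (R + r/2) ^ DIM('a)"
    by (simp add: mult.left_commute)
  then have "real (card X) * (r/2) ^ DIM('a) * 2 ^ DIM('a) \<le> (R + r/2) ^ DIM('a) * 2 ^ DIM('a)"
    by (intro mult_right_mono) auto
  also have "\<dots> = (2 * R + r) ^ DIM('a)"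
    unfolding power_mult_distrib[symmetric] by (simp add: algebra_simps)
  finally show ?thesis
    by (simp add: power_divide)
qed

text \<open>Scan the points one at a time and keep those that are not yet covered.\<close>

lemma ex_separated_net:
  fixes P :: "'a::metric_space set"
  assumes "finite P" and "0 \<le> r"
  shows "\<exists>X\<subseteq>P. pairwise (\<lambda>x y. r \<le> dist x y) X \<and> P \<subseteq> (\<Union>x\<in>X. cball x r)"
  using assms(1)
proof (induction P)
  case empty
  then show ?case by simp
next
  case (insert p P)
  then obtain X where X: "X \<subseteq> P" "pairwise (\<lambda>x y. r \<le> dist x y) X" "P \<subseteq> (\<Union>x\<in>X. cball x r)"
    by blast
  show ?case
  proof (cases "p \<in> (\<Union>x\<in>X. cball x r)")
    case True
    with X show ?thesis by (intro exI[of _ X]) auto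
  next
    case False
    then have "r \<le> dist x p \<and> r \<le> dist p x" if "x \<in> X" for x
      using that by (force simp: dist_commute)
    with X have "pairwise (\<lambda>x y. r \<le> dist x y) (insert p X)"
      by (auto simp: pairwise_insert)
    moreover have "insert p P \<subseteq> (\<Union>x\<in>insert p X. cball x r)"
      using X(3) assms(2) by auto
    ultimately show ?thesis
      using X(1) by (intro exI[of _ "insert p X"]) auto
  qed
qed

lemma pigeonhole_cover:
  assumes "finite X" and "finite P" and "P \<noteq> {}" and cover: "P \<subseteq> (\<Union>x\<in>X. B x)"
  shows "\<exists>x\<in>X. card P \<le> card X * card (P \<inter> B x)"
proof (rule ccontr)
  assume "\<not> ?thesis"
  then have less: "card X * card (P \<inter> B x) < card P" if "x \<in> X" for x
    using that by (auto simp: not_le)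
  have ne: "X \<noteq> {}"
    using assms(3) cover by auto
  have "card P = card (\<Union>x\<in>X. P \<inter> B x)"
    using cover by (intro arg_cong[of _ _ card]) auto
  also have "\<dots> \<le> (\<Sum>x\<in>X. card (P \<inter> B x))"
    using assms(1) by (rule card_UN_le)
  finally have "card X * card P \<le> (\<Sum>x\<in>X. card X * card (P \<inter> B x))"
    by (simp add: sum_distrib_left[symmetric])
  also have "\<dots> < (\<Sum>x\<in>X. card P)"
    using assms(1) ne less by (intro sum_strict_mono)
  finally show False by simp
qed

text \<open>
  The radius \<open>r = D / 7\<close> serves two opposing demands: \<open>D / 2 - r > 2 * r\<close>, which separates \<open>q\<close> from
  \<open>Q\<close>, needs \<open>r < D / 6\<close>, and the packing bound \<open>(2 * D / r + 1) ^ d \<le> 16 ^ d\<close> needs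
  \<open>r \<ge> 2 * D / 15\<close>.
\<close>

lemma ex_popular_far_ball:
  fixes P :: "'a::euclidean_space set"
  assumes fin: "finite P" and two: "card P \<ge> 2"
  shows "\<exists>Q q. Q \<subset> P \<and> Q \<noteq> {} \<and> q \<in> P - Q \<and> card P \<le> 16 ^ DIM('a) * card Q \<and>
           (\<forall>u\<in>Q. \<forall>v\<in>Q. dist u v < dist u q)"
proof -
  define D where "D = diameter P"
  have ne: "P \<noteq> {}" using two by auto
  obtain a b where ab: "a \<in> P" "b \<in> P" "dist a b = D"
    using diameter_compact_attained[OF finite_imp_compact[OF fin] ne] unfolding D_def by blast
  have le_D: "dist u v \<le> D" if "u \<in> P" "v \<in> P" for u v
    unfolding D_def using that fin by (intro diameter_bounded_bound finite_imp_bounded)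
  have "\<not> P \<subseteq> {a}"
    using two card_mono[of "{a}" P] by auto
  then obtain c where "c \<in> P" "c \<noteq> a" by auto
  then have "0 < dist a c" by simp
  also have "\<dots> \<le> D"
    using ab(1) \<open>c \<in> P\<close> by (rule le_D)
  finally have D_pos: "0 < D" .
  obtain X where X: "X \<subseteq> P" "pairwise (\<lambda>x y. D/7 \<le> dist x y) X" "P \<subseteq> (\<Union>x\<in>X. cball x (D/7))"
    using ex_separated_net[OF fin, of "D/7"] D_pos by auto
  have finX: "finite X"
    using X(1) fin finite_subset by blast
  have "real (card X) * (D/7) ^ DIM('a) \<le> (2 * D + D/7) ^ DIM('a)"
    using X le_D[OF ab(1)] D_pos by (intro packing_bound[OF finX, of a D]) auto
  also have "2 * D + D/7 = 15 * (D/7)" by simp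
  finally have "real (card X) \<le> 15 ^ DIM('a)"
    using D_pos unfolding power_mult_distrib by simp
  also have "(15::real) ^ DIM('a) \<le> 16 ^ DIM('a)"
    by (intro power_mono) auto
  finally have card_X: "card X \<le> 16 ^ DIM('a)"
    by (metis of_nat_le_iff of_nat_numeral of_nat_power)
  obtain x where x: "x \<in> X" "card P \<le> card X * card (P \<inter> cball x (D/7))"
    using pigeonhole_cover[OF finX fin ne X(3)] by blast
  define Q where "Q = P \<inter> cball x (D/7)"
  have "D \<le> dist x a + dist x b"
    using dist_triangle3[of a b x] ab(3) by simp
  then have "D/2 \<le> dist x a \<or> D/2 \<le> dist x b"
    by linarith
  then obtain q where q: "q \<in> P" "D/2 \<le> dist x q"
    using ab(1,2) by blast
  have far: "dist u v < dist u q" if "u \<in> Q" "v \<in> Q" for u v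
    using that dist_triangle3[of u v x] dist_triangle[of x q u] q(2) D_pos by (simp add: Q_def)
  have "q \<notin> Q"
    using q(2) D_pos by (auto simp: Q_def)
  moreover have "x \<in> Q"
    using x(1) X(1) D_pos by (auto simp: Q_def)
  moreover have "card P \<le> 16 ^ DIM('a) * card Q"
    using x(2) card_X unfolding Q_def by (meson mult_le_mono1 order_trans)
  ultimately show ?thesis
    using q(1) far by (intro exI[of _ Q] exI[of _ q]) (auto simp: Q_def)
qed

section \<open>Nearest neighbour stars\<close>

definition NN_star :: "'a::metric_space \<Rightarrow> 'a list \<Rightarrow> bool" where
  "NN_star c qs \<longleftrightarrow> distinct (c # qs) \<and> sorted_wrt (\<lambda>p q. dist q c < dist q p) qs"

text \<open>
  The far point produced by \<open>ex_popular_far_ball\<close> beats every distance inside \<open>Q\<close>, so it can precede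
  any star inside \<open>Q\<close> without knowing which of its points is the centre.
\<close>

lemma ex_NN_star:
  fixes P :: "'a::euclidean_space set"
  assumes "finite P" and "P \<noteq> {}"
  shows "\<exists>c qs. NN_star c qs \<and> set (c # qs) \<subseteq> P \<and> card P \<le> (16 ^ DIM('a)) ^ length qs"
  using assms
proof (induction P rule: finite_psubset_induct)
  case (psubset P)
  show ?case
  proof (cases "card P \<ge> 2")
    case True
    then obtain Q q where Q: "Q \<subset> P" "Q \<noteq> {}" "q \<in> P - Q" "card P \<le> 16 ^ DIM('a) * card Q"
        "\<forall>u\<in>Q. \<forall>v\<in>Q. dist u v < dist u q"
      using ex_popular_far_ball[OF psubset.hyps(1)] by metis
    obtain c qs where star: "NN_star c qs" "set (c # qs) \<subseteq> Q"
        and card_Q: "card Q \<le> (16 ^ DIM('a)) ^ length qs"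
      using psubset.IH[OF Q(1,2)] by blast
    have "NN_star c (q # qs)"
      using star Q(3,5) by (auto simp: NN_star_def)
    moreover have "set (c # q # qs) \<subseteq> P"
      using star(2) Q(1,3) by auto
    moreover have "card P \<le> 16 ^ DIM('a) * (16 ^ DIM('a)) ^ length qs"
      using Q(4) card_Q by (meson mult_le_mono2 order_trans)
    ultimately show ?thesis
      by (intro exI[of _ c] exI[of _ "q # qs"]) simp
  next
    case False
    obtain c where "c \<in> P" using psubset.prems by blast
    with False show ?thesis
      by (intro exI[of _ c] exI[of _ "[]"]) (simp add: NN_star_def)
  qed
qed

lemma NN_star_arc:
  assumes star: "NN_star c qs" and q: "q \<in> set qs"
  shows "(q, c) \<in> parcs (ordered_NNG (c # qs @ rs))"
proof -
  let ?ps = "c # qs @ rs"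
  obtain i where i: "i < length qs" "q = qs ! i"
    using q by (metis in_set_conv_nth)
  have nearest: "dist q c \<le> dist q (?ps ! k)" if "k < Suc i" for k
  proof (cases k)
    case (Suc j)
    then have "j < i" using that by simp
    then have "dist (qs ! i) c < dist (qs ! i) (qs ! j)"
      using star i(1)
      by (intro sorted_wrt_nth_less[of "\<lambda>p q. dist q c < dist q p"]) (simp_all add: NN_star_def)
    with Suc i \<open>j < i\<close> show ?thesis
      by (simp add: nth_append)
  qed simp
  have idx: "?ps ! Suc i = q" "?ps ! 0 = c"
    using i by (simp_all add: nth_append)
  have "(q, c) = (?ps ! Suc i, ?ps ! 0) \<and> Suc i < length ?ps \<and> 0 < Suc i \<and>
      (\<forall>k<Suc i. dist (?ps ! Suc i) (?ps ! 0) \<le> dist (?ps ! Suc i) (?ps ! k))"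
    unfolding idx using nearest i(1) by simp
  then have "\<exists>i j. (q, c) = (?ps ! i, ?ps ! j) \<and> i < length ?ps \<and> j < i \<and>
      (\<forall>k<i. dist (?ps ! i) (?ps ! j) \<le> dist (?ps ! i) (?ps ! k))"
    by (intro exI)
  then show ?thesis
    unfolding ordered_NNG_def pair_pre_digraph.select_convs mem_Collect_eq .
qed

lemma NN_star_length_le_max_in_degree:
  assumes star: "NN_star c qs"
  shows "length qs \<le> max_in_degree (with_proj (ordered_NNG (c # qs @ rs)))"
proof -
  let ?ps = "c # qs @ rs"
  let ?G = "with_proj (ordered_NNG ?ps)"
  interpret pair_fin_digraph "ordered_NNG ?ps"
    by (rule ordered_NNG_fin_digraph)
  have "length qs = card ((\<lambda>q. (q, c)) ` set qs)"
    using star by (simp add: NN_star_def card_image inj_on_def distinct_card)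
  also have "\<dots> \<le> in_degree ?G c"
    unfolding in_degree_def
  proof (rule card_mono)
    show "(\<lambda>q. (q, c)) ` set qs \<subseteq> in_arcs ?G c"
      using NN_star_arc[OF star] by (auto simp: in_arcs_def)
  qed (rule finite_in_arcs)
  also have "\<dots> \<le> max_in_degree ?G"
    unfolding max_in_degree_def by (intro Max_ge) (auto simp: ordered_NNG_def)
  finally show ?thesis .
qed

theorem theorem2:
  fixes P :: "(real ^ 'd) set" and n :: nat
  assumes "n \<ge> 1" and "finite P" and "card P = n" and "general_position P"
  shows "\<exists>ps. is_order P ps \<and>
    real (max_in_degree (with_proj (ordered_NNG ps))) \<ge> log 2 (real n) / (4 * real CARD('d))"
proof -
  have "P \<noteq> {}" using assms(1,3) by auto
  then obtain c qs where star: "NN_star c qs" and sub: "set (c # qs) \<subseteq> P"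
      and card_P: "card P \<le> (16 ^ CARD('d)) ^ length qs"
    using ex_NN_star[OF assms(2)] by auto
  obtain rs where rs: "set rs = P - set (c # qs)" "distinct rs"
    using finite_distinct_list[of "P - set (c # qs)"] assms(2) by auto
  let ?ps = "c # qs @ rs"
  have order: "is_order P ?ps"
    using rs sub star by (auto simp: is_order_def NN_star_def)
  have "(16::nat) ^ CARD('d) = 2 ^ (4 * CARD('d))"
    by (simp add: power_mult)
  then have "n \<le> 2 ^ (4 * CARD('d) * length qs)"
    using card_P assms(3) by (simp add: power_mult)
  then have "real n \<le> 2 ^ (4 * CARD('d) * length qs)"
    by (metis of_nat_le_iff of_nat_numeral of_nat_power)
  then have "log 2 (real n) \<le> real (4 * CARD('d) * length qs)"
    using assms(1) by (intro log2_of_power_le) auto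
  then have "log 2 (real n) / (4 * real CARD('d)) \<le> real (length qs)"
    by (simp add: divide_le_eq mult.commute)
  also have "\<dots> \<le> real (max_in_degree (with_proj (ordered_NNG ?ps)))"
    using NN_star_length_le_max_in_degree[OF star] by simp
  finally show ?thesis
    using order by blast
qed

end
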